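(* Fix an ordered partition $\Pi=\{I_1,\dots,I_m\}$ with positive leaf masses $p_1,\dots,p_m$ and rank diameters $R_1,\dots,R_m$, and suppose $\Pi$ has a normalized discrete power-law profile with constants $a,b,\alpha>0$ and hardness values $\kappa_j>0$. Let $B_{\mathrm{eff}}=B+m$. Then the optimal fixed-partition cost $$\min\Big\{H_\mu(\Pi)+\sum_j p_j\log(1+\Delta_j):\ \Delta_j\in\{0,\dots,R_j\},\ \sum_j\mathsf{Comp}_{I_j,\mathcal M}(\Delta_j)\le B\Big\}$$ equals, up to constants depending only on $a,b,\alpha$, $$H_\mu(\Pi)+\sum_{j=1}^m p_j\log\Big(1+\min\Big\{R_j,\max\Big\{1,\big(\tfrac{\kappa_j}{B_{\mathrm{eff}}p_j}\big)^{1/\alpha}\Big\}\Big\}\Big).$$ In the interior regime where $1\ll(\kappa_j/(B_{\mathrm{eff}}p_j))^{1/\alpha}\ll R_j$ for the leaves contributing to the repair term, this simplifies to $\Theta\big(H_\mu(\Pi)+\frac1\alpha\sum_jp_j\log^+\frac{\kappa_j}{B_{\mathrm{eff}}p_j}\big)$. An optimal allocation may be chosen with $1+\Delta_j^\star=\Theta\big(\min\{1+R_j,\max\{1,(\kappa_j/(B_{\mathrm{eff}}p_j))^{1/\alpha}\}\}\big)$ after integer rounding.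
   Context: $S$ is a finite ordered set of $n$ keys in a totally ordered universe, $\mathrm{rank}_S(q)=|\{x\in S:x\le q\}|$, $\mu$ a probability measure on query keys, $p_j=\mu(I_j)$, logs base 2, $\log^+x=\max\{0,\log x\}$, $H_\mu(\Pi)=\sum_jp_j\log(1/p_j)$. Rank diameter $R_j=1+\max_{q,q'\in I_j}|\mathrm{rank}_S(q)-\mathrm{rank}_S(q')|$. $\mathcal M=(\mathcal M_a)_{a\ge0}$ is an atomized model family (monotone classes of local rank predictors, a predictor in $\mathcal M_a$ being encoded by at most $a$ constant-size records/atoms; $\mathcal M_0$ contains only the empty predictor certifying radius $R_I$). $\mathsf{Comp}_{I,\mathcal M}(\Delta)=\min\{a:\exists h\in\mathcal M_a,\ |h(q)-\mathrm{rank}_S(q)|\le\Delta\ \forall q\in I\}$. Normalized discrete power-law profile: there are constants $a,b,\alpha>0$ and $\kappa_j>0$ such that for every $j$ and every integer $0\le\Delta\le R_j$, $a(1+\kappa_j(1+\Delta)^{-\alpha})\le 1+\mathsf{Comp}_{I_j,\mathcal M}(\Delta)\le b(1+\kappa_j(1+\Delta)^{-\alpha})$, and $\mathsf{Comp}_{I_j,\mathcal M}(R_j)=0$.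
   Formalization: "Up to constants" is additive; upper bounds and the allocation need B ≥ bm (for all B ≥ 0: budget b(B+m) in the optimum); the interior upper bound adds the mass of non-contributing leaves; the allocation is optimal up to an additive constant. The literal claims fail otherwise. *)

theory Defs
  imports "HOL-Probability.Probability_Measure"
begin

definition key_rank :: "'a::linorder set \<Rightarrow> 'a \<Rightarrow> nat" where
  "key_rank S q = card {x \<in> S. x \<le> q}"

definition key_interval :: "'a::linorder set \<Rightarrow> bool" where
  "key_interval J \<longleftrightarrow> J \<noteq> {} \<and> (\<forall>x\<in>J. \<forall>z\<in>J. {x..z} \<subseteq> J)"

text \<open>Ranks are at most card S, so for finite S and nonempty J the maximum is over a finite set.\<close>

definition rank_diam :: "'a::linorder set \<Rightarrow> 'a set \<Rightarrow> nat" where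
  "rank_diam S J =
     1 + Max ((\<lambda>(q, q'). nat \<bar>int (key_rank S q) - int (key_rank S q')\<bar>) ` (J \<times> J))"

definition ordered_partition :: "nat \<Rightarrow> (nat \<Rightarrow> 'a::linorder set) \<Rightarrow> bool" where
  "ordered_partition m I \<longleftrightarrow>
     (\<forall>j\<in>{1..m}. key_interval (I j)) \<and>
     (\<forall>i\<in>{1..m}. \<forall>j\<in>{1..m}. i < j \<longrightarrow> (\<forall>x\<in>I i. \<forall>y\<in>I j. x < y)) \<and>
     (\<Union>j\<in>{1..m}. I j) = UNIV"

text \<open>
  Predictors are local to an interval J, so classes and decoding both depend on J.
  The type 'r is the type of atoms, and the predictor encoded by the list rs of atoms is
  decode J rs; in particular decode J [] is the empty predictor.
\<close>

definition atomized_family ::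
    "'a::linorder set \<Rightarrow> ('a set \<Rightarrow> 'r list \<Rightarrow> 'a \<Rightarrow> real)
      \<Rightarrow> ('a set \<Rightarrow> nat \<Rightarrow> ('a \<Rightarrow> real) set) \<Rightarrow> bool" where
  "atomized_family S decode M \<longleftrightarrow>
     (\<forall>J. key_interval J \<longrightarrow>
        mono (M J) \<and>
        (\<forall>k. \<forall>h\<in>M J k. \<exists>rs. length rs \<le> k \<and> h = decode J rs) \<and>
        M J 0 = {decode J []} \<and>
        (\<forall>q\<in>J. \<bar>decode J [] q - real (key_rank S q)\<bar> \<le> real (rank_diam S J)))"

text \<open>The value is \<open>\<infinity>\<close> if no predictor of the family has error at most \<open>\<Delta>\<close> on J.\<close>

definition Comp ::
    "'a::linorder set \<Rightarrow> ('a set \<Rightarrow> nat \<Rightarrow> ('a \<Rightarrow> real) set) \<Rightarrow> 'a set \<Rightarrow> nat \<Rightarrow> enat" where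
  "Comp S M J \<Delta> =
     Inf (enat ` {k. \<exists>h\<in>M J k. \<forall>q\<in>J. \<bar>h q - real (key_rank S q)\<bar> \<le> real \<Delta>})"

definition power_law_profile ::
    "'a::linorder set \<Rightarrow> ('a set \<Rightarrow> nat \<Rightarrow> ('a \<Rightarrow> real) set) \<Rightarrow> nat \<Rightarrow> (nat \<Rightarrow> 'a set)
      \<Rightarrow> real \<Rightarrow> real \<Rightarrow> real \<Rightarrow> (nat \<Rightarrow> real) \<Rightarrow> bool" where
  "power_law_profile S M m I a b \<alpha> \<kappa> \<longleftrightarrow>
     0 < a \<and> 0 < b \<and> 0 < \<alpha> \<and>
     (\<forall>j\<in>{1..m}.
        0 < \<kappa> j \<and>
        (\<forall>\<Delta>\<le>rank_diam S (I j).
           ereal (a * (1 + \<kappa> j * (1 + real \<Delta>) powr (-\<alpha>)))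
             \<le> 1 + ereal_of_enat (Comp S M (I j) \<Delta>) \<and>
           1 + ereal_of_enat (Comp S M (I j) \<Delta>)
             \<le> ereal (b * (1 + \<kappa> j * (1 + real \<Delta>) powr (-\<alpha>)))) \<and>
        Comp S M (I j) (rank_diam S (I j)) = 0)"

definition partition_entropy :: "'a measure \<Rightarrow> nat \<Rightarrow> (nat \<Rightarrow> 'a set) \<Rightarrow> real" where
  "partition_entropy \<mu> m I = (\<Sum>j\<in>{1..m}. measure \<mu> (I j) * log 2 (1 / measure \<mu> (I j)))"

definition feasible ::
    "'a::linorder set \<Rightarrow> ('a set \<Rightarrow> nat \<Rightarrow> ('a \<Rightarrow> real) set) \<Rightarrow> nat \<Rightarrow> (nat \<Rightarrow> 'a set)
      \<Rightarrow> real \<Rightarrow> (nat \<Rightarrow> nat) set" where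
  "feasible S M m I B =
     {\<Delta> \<in> (\<Pi>\<^sub>E j\<in>{1..m}. {0..rank_diam S (I j)}).
        ereal_of_enat (\<Sum>j\<in>{1..m}. Comp S M (I j) (\<Delta> j)) \<le> ereal B}"

definition cost :: "'a measure \<Rightarrow> nat \<Rightarrow> (nat \<Rightarrow> 'a set) \<Rightarrow> (nat \<Rightarrow> nat) \<Rightarrow> real" where
  "cost \<mu> m I \<Delta> =
     partition_entropy \<mu> m I + (\<Sum>j\<in>{1..m}. measure \<mu> (I j) * log 2 (1 + real (\<Delta> j)))"

definition opt_cost ::
    "'a::linorder set \<Rightarrow> 'a measure \<Rightarrow> ('a set \<Rightarrow> nat \<Rightarrow> ('a \<Rightarrow> real) set) \<Rightarrow> nat
      \<Rightarrow> (nat \<Rightarrow> 'a set) \<Rightarrow> real \<Rightarrow> real" where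
  "opt_cost S \<mu> M m I B = Min (cost \<mu> m I ` feasible S M m I B)"

definition hardness_ratio ::
    "'a measure \<Rightarrow> nat \<Rightarrow> (nat \<Rightarrow> 'a set) \<Rightarrow> (nat \<Rightarrow> real) \<Rightarrow> real \<Rightarrow> nat \<Rightarrow> real" where
  "hardness_ratio \<mu> m I \<kappa> B j = \<kappa> j / ((B + real m) * measure \<mu> (I j))"

definition profile_cost ::
    "'a::linorder set \<Rightarrow> 'a measure \<Rightarrow> nat \<Rightarrow> (nat \<Rightarrow> 'a set) \<Rightarrow> real \<Rightarrow> (nat \<Rightarrow> real)
      \<Rightarrow> real \<Rightarrow> real" where
  "profile_cost S \<mu> m I \<alpha> \<kappa> B =
     partition_entropy \<mu> m I +
     (\<Sum>j\<in>{1..m}. measure \<mu> (I j) *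
        log 2 (1 + min (real (rank_diam S (I j)))
                       (max 1 (hardness_ratio \<mu> m I \<kappa> B j powr (1 / \<alpha>)))))"

text \<open>
  The comparison with the optimum is additive: the optimum can be 0 (one leaf, exact predictor
  affordable), whereas \<open>profile_cost\<close> is always at least 1. Moreover the profile only gives
  \<open>1 + Comp \<le> b * (1 + \<dots>)\<close>, so a budget below about \<open>b - 1\<close> atoms per leaf may buy nothing
  at all; upper bounds therefore need a budget of at least \<open>b\<close> atoms per leaf, or the budget
  \<open>b * (B + m)\<close> in place of B.
\<close>

definition interior_cost ::
    "'a measure \<Rightarrow> nat \<Rightarrow> (nat \<Rightarrow> 'a set) \<Rightarrow> real \<Rightarrow> (nat \<Rightarrow> real) \<Rightarrow> real \<Rightarrow> real" where
  "interior_cost \<mu> m I \<alpha> \<kappa> B =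
     partition_entropy \<mu> m I +
     1 / \<alpha> * (\<Sum>j\<in>{1..m}. measure \<mu> (I j) * max 0 (log 2 (hardness_ratio \<mu> m I \<kappa> B j)))"

text \<open>
  A leaf contributes to the repair term iff its hardness ratio exceeds 1. For such leaves
  \<open>1 \<lless> x \<lless> R\<close> is read as \<open>C \<le> x \<le> R\<close>, for a constant C.
\<close>

definition interior_regime ::
    "'a::linorder set \<Rightarrow> 'a measure \<Rightarrow> nat \<Rightarrow> (nat \<Rightarrow> 'a set) \<Rightarrow> real \<Rightarrow> (nat \<Rightarrow> real)
      \<Rightarrow> real \<Rightarrow> real \<Rightarrow> bool" where
  "interior_regime S \<mu> m I \<alpha> \<kappa> B C \<longleftrightarrow>
     (\<forall>j\<in>{1..m}. 1 < hardness_ratio \<mu> m I \<kappa> B j \<longrightarrow>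
        C \<le> hardness_ratio \<mu> m I \<kappa> B j powr (1 / \<alpha>) \<and>
        hardness_ratio \<mu> m I \<kappa> B j powr (1 / \<alpha>) \<le> real (rank_diam S (I j)))"

definition noncontributing_mass ::
    "'a measure \<Rightarrow> nat \<Rightarrow> (nat \<Rightarrow> 'a set) \<Rightarrow> (nat \<Rightarrow> real) \<Rightarrow> real \<Rightarrow> real" where
  "noncontributing_mass \<mu> m I \<kappa> B =
     (\<Sum>j\<in>{j \<in> {1..m}. hardness_ratio \<mu> m I \<kappa> B j \<le> 1}. measure \<mu> (I j))"

definition target_width ::
    "'a::linorder set \<Rightarrow> 'a measure \<Rightarrow> nat \<Rightarrow> (nat \<Rightarrow> 'a set) \<Rightarrow> real \<Rightarrow> (nat \<Rightarrow> real)
      \<Rightarrow> real \<Rightarrow> nat \<Rightarrow> real" where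
  "target_width S \<mu> m I \<alpha> \<kappa> B j =
     min (1 + real (rank_diam S (I j)))
         (max 1 (hardness_ratio \<mu> m I \<kappa> B j powr (1 / \<alpha>)))"

end

theory Submission imports Defs begin

text \<open>
  Write \<open>N = B + m\<close>, \<open>x\<^sub>j = \<kappa>\<^sub>j / (N p\<^sub>j)\<close> and \<open>w\<^sub>j = x\<^sub>j powr (1 / \<alpha>)\<close>, and for a feasible
  allocation put \<open>y\<^sub>j = x\<^sub>j (1 + \<Delta>\<^sub>j) powr (-\<alpha>)\<close>. The lower half of the profile turns the budget
  constraint into \<open>\<Sum> p\<^sub>j y\<^sub>j \<le> 1 / a\<close>, and
  \<open>log w\<^sub>j \<le> log (1 + \<Delta>\<^sub>j) + log (1 + y\<^sub>j) / \<alpha>\<close>. With \<open>log (1 + y) \<le> y / ln 2\<close> this bounds the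
  profile cost by the optimum plus a constant. With the termwise bound
  \<open>1 + y\<^sub>j \<le> (1 + 1 / a) / p\<^sub>j\<close> instead, the error is absorbed by the entropy and, if all contributing
  \<open>w\<^sub>j\<close> are large, by the repair term itself, which gives the multiplicative bound in the interior
  regime. Conversely, rounding \<open>K max(1, w\<^sub>j)\<close> up and truncating it at \<open>R\<^sub>j\<close>, for a constant \<open>K\<close>,
  is feasible by the upper half of the profile.
\<close>

section \<open>The rounding constant\<close>

definition rounding_factor :: "real \<Rightarrow> real \<Rightarrow> real" where
  "rounding_factor b \<alpha> = ((b + 1)\<^sup>2) powr (1 / \<alpha>)"

text \<open>
  The value is chosen so that the leaves not truncated at \<open>R\<^sub>j\<close> need, beyond \<open>b - 1\<close> atoms per leaf,
  at most \<open>b (B + m) / (b + 1)\<^sup>2\<close> atoms in total, which fits into \<open>B\<close> as soon as \<open>b m \<le> B\<close>.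
\<close>

lemma rounding_factor_ge_1:
  assumes "0 < b" "0 < \<alpha>"
  shows "1 \<le> rounding_factor b \<alpha>"
  unfolding rounding_factor_def using assms
  by (intro ge_one_powr_ge_zero) (auto simp: power2_eq_square algebra_simps)

lemma rounding_factor_powr:
  assumes "0 < b" "0 < \<alpha>"
  shows "rounding_factor b \<alpha> powr (-\<alpha>) = 1 / (b + 1)\<^sup>2"
  unfolding rounding_factor_def using assms
  by (simp add: powr_powr powr_minus divide_simps)

lemma log2_one_plus_le:
  assumes "0 \<le> y"
  shows "log 2 (1 + y) \<le> y / ln 2"
  using assms ln_add_one_self_le_self[of y] by (simp add: log_def divide_right_mono)

section \<open>Finite atom counts and attainment of the optimum\<close>

locale profiled_partition = prob_space \<mu> for \<mu> :: "'a::linorder measure" +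
  fixes S :: "'a set" and M :: "'a set \<Rightarrow> nat \<Rightarrow> ('a \<Rightarrow> real) set"
    and m :: nat and I :: "nat \<Rightarrow> 'a set" and a b \<alpha> :: real and \<kappa> :: "nat \<Rightarrow> real"
    and B :: real
  assumes space_UNIV: "space \<mu> = UNIV"
    and partition: "ordered_partition m I"
    and leaf_measurable: "j \<in> {1..m} \<Longrightarrow> I j \<in> sets \<mu>"
    and leaf_pos: "j \<in> {1..m} \<Longrightarrow> 0 < measure \<mu> (I j)"
    and profile: "power_law_profile S M m I a b \<alpha> \<kappa>"
    and budget_nonneg: "0 \<le> B"
begin

abbreviation p :: "nat \<Rightarrow> real" where "p j \<equiv> measure \<mu> (I j)"
abbreviation R :: "nat \<Rightarrow> nat" where "R j \<equiv> rank_diam S (I j)"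
abbreviation x :: "nat \<Rightarrow> real" where "x j \<equiv> hardness_ratio \<mu> m I \<kappa> B j"
abbreviation w :: "nat \<Rightarrow> real" where "w j \<equiv> x j powr (1 / \<alpha>)"
abbreviation H :: real where "H \<equiv> partition_entropy \<mu> m I"
abbreviation OPT :: "real \<Rightarrow> real" where "OPT \<equiv> opt_cost S \<mu> M m I"
abbreviation F :: real where "F \<equiv> profile_cost S \<mu> m I \<alpha> \<kappa> B"
abbreviation G :: real where "G \<equiv> interior_cost \<mu> m I \<alpha> \<kappa> B"

text \<open>\<open>the_enat\<close> is meaningful only below infinity. For widths up to
  \<open>R j\<close> the upper half of the profile is a finite bound on \<open>Comp\<close>, so
  there the conversion loses nothing and budgets become real sums.\<close>

definition atoms :: "nat \<Rightarrow> nat \<Rightarrow> nat" where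
  "atoms j \<Delta> = the_enat (Comp S M (I j) \<Delta>)"

lemma constants_pos: "0 < a" "0 < b" "0 < \<alpha>"
  using profile by (auto simp: power_law_profile_def)

lemma hardness_pos: "j \<in> {1..m} \<Longrightarrow> 0 < \<kappa> j"
  using profile by (auto simp: power_law_profile_def)

lemma rank_diam_ge_1: "1 \<le> R j"
  by (simp add: rank_diam_def)

lemma Comp_eq_atoms:
  assumes "j \<in> {1..m}" "\<Delta> \<le> R j"
  shows "Comp S M (I j) \<Delta> = enat (atoms j \<Delta>)"
proof -
  have "1 + ereal_of_enat (Comp S M (I j) \<Delta>) \<le> ereal (b * (1 + \<kappa> j * (1 + real \<Delta>) powr (-\<alpha>)))"
    using profile assms by (auto simp: power_law_profile_def)
  thus ?thesis
    by (cases "Comp S M (I j) \<Delta>") (auto simp: atoms_def)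
qed

lemma atoms_bounds:
  assumes "j \<in> {1..m}" "\<Delta> \<le> R j"
  shows "a * (1 + \<kappa> j * (1 + real \<Delta>) powr (-\<alpha>)) \<le> 1 + real (atoms j \<Delta>)"
    and "1 + real (atoms j \<Delta>) \<le> b * (1 + \<kappa> j * (1 + real \<Delta>) powr (-\<alpha>))"
proof -
  have "ereal (a * (1 + \<kappa> j * (1 + real \<Delta>) powr (-\<alpha>))) \<le> 1 + ereal_of_enat (Comp S M (I j) \<Delta>)"
    "1 + ereal_of_enat (Comp S M (I j) \<Delta>) \<le> ereal (b * (1 + \<kappa> j * (1 + real \<Delta>) powr (-\<alpha>)))"
    using profile assms by (auto simp: power_law_profile_def)
  thus "a * (1 + \<kappa> j * (1 + real \<Delta>) powr (-\<alpha>)) \<le> 1 + real (atoms j \<Delta>)"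
    and "1 + real (atoms j \<Delta>) \<le> b * (1 + \<kappa> j * (1 + real \<Delta>) powr (-\<alpha>))"
    by (simp_all add: Comp_eq_atoms[OF assms] one_ereal_def)
qed

lemma atoms_rank_diam: "j \<in> {1..m} \<Longrightarrow> atoms j (R j) = 0"
  using profile Comp_eq_atoms[of j "R j"] by (auto simp: power_law_profile_def zero_enat_def)

lemma feasible_iff:
  "\<Delta> \<in> feasible S M m I D \<longleftrightarrow>
     \<Delta> \<in> (\<Pi>\<^sub>E j\<in>{1..m}. {0..R j}) \<and> (\<Sum>j\<in>{1..m}. real (atoms j (\<Delta> j))) \<le> D"
proof (cases "\<Delta> \<in> (\<Pi>\<^sub>E j\<in>{1..m}. {0..R j})")
  case True
  hence "(\<Sum>j\<in>{1..m}. Comp S M (I j) (\<Delta> j)) = (\<Sum>j\<in>{1..m}. enat (atoms j (\<Delta> j)))"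
    by (intro sum.cong refl Comp_eq_atoms) (auto simp: PiE_iff)
  also have "\<dots> = enat (\<Sum>j\<in>{1..m}. atoms j (\<Delta> j))"
    by (simp add: of_nat_eq_enat[symmetric])
  finally show ?thesis
    using True by (simp add: feasible_def)
qed (simp add: feasible_def)

lemma finite_feasible: "finite (feasible S M m I D)"
  by (rule finite_subset[of _ "\<Pi>\<^sub>E j\<in>{1..m}. {0..R j}"])
     (auto simp: feasible_def intro!: finite_PiE)

lemma opt_cost_le: "\<Delta> \<in> feasible S M m I D \<Longrightarrow> OPT D \<le> cost \<mu> m I \<Delta>"
  unfolding opt_cost_def by (intro Min_le) (auto simp: finite_feasible)

lemma opt_cost_attained:
  assumes "0 \<le> D"
  obtains \<Delta> where "\<Delta> \<in> feasible S M m I D" "OPT D = cost \<mu> m I \<Delta>"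
proof -
  \<comment> \<open>Width \<open>R j\<close> costs no atoms, so this choice fits every nonnegative
    budget; it keeps \<open>Min\<close> from being taken over the empty set.\<close>
  have "restrict R {1..m} \<in> feasible S M m I D"
    using assms by (auto simp: feasible_iff atoms_rank_diam)
  hence "OPT D \<in> cost \<mu> m I ` feasible S M m I D"
    unfolding opt_cost_def by (intro Min_in) (auto simp: finite_feasible)
  thus thesis
    using that by auto
qed

section \<open>Leaf masses and hardness ratios\<close>

lemma leaf_mass_sum: "(\<Sum>j\<in>{1..m}. p j) = 1"
proof -
  \<comment> \<open>By the order of the leaves, a point common to two of them would be smaller than
    itself.\<close>
  have "disjoint_family_on I {1..m}"
    unfolding disjoint_family_on_def
  proof (intro ballI impI)
    fix i j assume "i \<in> {1..m}" "j \<in> {1..m}" "i \<noteq> j"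
    thus "I i \<inter> I j = {}"
      using partition unfolding ordered_partition_def
      by (metis disjoint_iff less_irrefl linorder_neqE_nat)
  qed
  hence "measure \<mu> (\<Union>j\<in>{1..m}. I j) = (\<Sum>j\<in>{1..m}. p j)"
    by (intro finite_measure_finite_Union) (use leaf_measurable in auto)
  moreover have "(\<Union>j\<in>{1..m}. I j) = space \<mu>"
    using partition by (simp add: ordered_partition_def space_UNIV)
  ultimately show ?thesis
    by (simp add: prob_space)
qed

lemma m_pos: "0 < m"
  using leaf_mass_sum by (cases m) auto

lemma ratio_pos: "j \<in> {1..m} \<Longrightarrow> 0 < x j"
  using hardness_pos[of j] leaf_pos[of j] budget_nonneg m_pos
  by (simp add: hardness_ratio_def add_nonneg_pos)

lemma hardness_eq: "j \<in> {1..m} \<Longrightarrow> \<kappa> j = (B + real m) * p j * x j"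
  using leaf_pos[of j] budget_nonneg m_pos
  by (simp add: hardness_ratio_def add_nonneg_pos less_imp_neq[symmetric])

lemma entropy_term_nonneg: "j \<in> {1..m} \<Longrightarrow> 0 \<le> p j * log 2 (1 / p j)"
  using leaf_pos[of j] by simp

lemma entropy_nonneg: "0 \<le> H"
  unfolding partition_entropy_def by (intro sum_nonneg entropy_term_nonneg) auto

lemma log_width: "j \<in> {1..m} \<Longrightarrow> log 2 (w j) = log 2 (x j) / \<alpha>"
  using ratio_pos[of j] by (simp add: log_powr)

section \<open>Profile cost against the optimum\<close>

text \<open>The summand factor equals \<open>(w j / (1 + \<Delta> j)) powr \<alpha>\<close> and
  measures how far the width falls short of \<open>w j\<close>. Since
  \<open>\<kappa> j = (B + m) * p j * x j\<close>, the lower half of the profile sums to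
  \<open>a * (B + m)\<close> times the left side, while the atoms together with the additive one of
  each leaf make at most \<open>B + m\<close>. The effective budget cancels.\<close>

lemma weighted_overshoot_le:
  assumes "\<Delta> \<in> feasible S M m I B"
  shows "(\<Sum>j\<in>{1..m}. p j * (x j * (1 + real (\<Delta> j)) powr (-\<alpha>))) \<le> 1 / a"
proof -
  define y where "y j = x j * (1 + real (\<Delta> j)) powr (-\<alpha>)" for j
  have N: "0 < B + real m"
    using budget_nonneg m_pos by simp
  have "a * ((B + real m) * (\<Sum>j\<in>{1..m}. p j * y j))
      = (\<Sum>j\<in>{1..m}. a * (\<kappa> j * (1 + real (\<Delta> j)) powr (-\<alpha>)))"
    unfolding sum_distrib_left by (intro sum.cong refl) (simp add: hardness_eq y_def mult_ac)
  also have "\<dots> \<le> (\<Sum>j\<in>{1..m}. 1 + real (atoms j (\<Delta> j)))"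
  proof (intro sum_mono)
    fix j assume j: "j \<in> {1..m}"
    hence "\<Delta> j \<le> R j"
      using assms by (auto simp: feasible_iff PiE_iff)
    from atoms_bounds(1)[OF j this] constants_pos(1)
    show "a * (\<kappa> j * (1 + real (\<Delta> j)) powr (-\<alpha>)) \<le> 1 + real (atoms j (\<Delta> j))"
      by (simp add: distrib_left)
  qed
  also have "\<dots> \<le> B + real m"
    using assms by (simp add: feasible_iff sum.distrib)
  finally have "(B + real m) * (a * (\<Sum>j\<in>{1..m}. p j * y j)) \<le> (B + real m) * 1"
    by (simp add: mult_ac)
  hence "a * (\<Sum>j\<in>{1..m}. p j * y j) \<le> 1"
    using N by simp
  thus ?thesis
    using constants_pos(1) by (simp add: y_def field_simps)
qed

text \<open>With \<open>y = x j * (1 + d) powr (-\<alpha>)\<close>, taking logarithms gives an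
  equation for \<open>log 2 (w j)\<close> with correction \<open>log 2 y / \<alpha>\<close>. Using
  \<open>1 + y\<close> in place of \<open>y\<close> makes the correction nonnegative, which also
  settles \<open>w j \<le> 1\<close>, and gives a logarithm that is at most linear in
  \<open>y\<close>.\<close>

lemma log_width_le:
  assumes "j \<in> {1..m}"
  shows "log 2 (max 1 (w j))
    \<le> log 2 (1 + real d) + log 2 (1 + x j * (1 + real d) powr (-\<alpha>)) / \<alpha>"
proof (cases "w j \<le> 1")
  case True
  have "0 \<le> log 2 (1 + real d)" "0 \<le> log 2 (1 + x j * (1 + real d) powr (-\<alpha>))"
    using ratio_pos[OF assms] by (auto simp: zero_le_log_cancel_iff add_pos_nonneg)
  thus ?thesis
    using True constants_pos(3) by (simp add: max_def)
next
  case False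
  have x: "0 < x j"
    by (rule ratio_pos[OF assms])
  define y where "y = x j * (1 + real d) powr (-\<alpha>)"
  have y: "0 < y"
    using x by (simp add: y_def)
  have "log 2 y = log 2 (x j) - \<alpha> * log 2 (1 + real d)"
    using x by (simp add: y_def log_mult log_powr)
  hence "log 2 (x j) / \<alpha> = log 2 (1 + real d) + log 2 y / \<alpha>"
    using constants_pos(3) by (simp add: field_simps)
  moreover have "log 2 y / \<alpha> \<le> log 2 (1 + y) / \<alpha>"
    using y constants_pos(3) by (simp add: divide_right_mono)
  ultimately show ?thesis
    using False assms by (simp add: max_def log_width y_def)
qed

lemma profile_cost_le_cost:
  assumes "\<Delta> \<in> feasible S M m I B"
  shows "F \<le> cost \<mu> m I \<Delta> + (1 + 1 / (\<alpha> * a * ln 2))"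
proof -
  define y where "y j = x j * (1 + real (\<Delta> j)) powr (-\<alpha>)" for j
  have y: "0 \<le> y j" if "j \<in> {1..m}" for j
    using ratio_pos[OF that] by (simp add: y_def)
  have "F - H \<le> (\<Sum>j\<in>{1..m}. p j * log 2 (1 + real (\<Delta> j)) + (p j + p j * y j / (\<alpha> * ln 2)))"
    unfolding profile_cost_def add_diff_cancel_left'
  proof (intro sum_mono)
    fix j assume j: "j \<in> {1..m}"
    have "log 2 (1 + min (real (R j)) (max 1 (w j))) \<le> log 2 (2 * max 1 (w j))"
      by (subst log_le_cancel_iff) (auto simp: min_def max_def)
    also have "\<dots> = 1 + log 2 (max 1 (w j))"
      by (subst log_mult) auto
    also have "\<dots> \<le> 1 + (log 2 (1 + real (\<Delta> j)) + log 2 (1 + y j) / \<alpha>)"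
      unfolding y_def using log_width_le[OF j] by simp
    also have "\<dots> \<le> 1 + (log 2 (1 + real (\<Delta> j)) + (y j / ln 2) / \<alpha>)"
      using log2_one_plus_le[OF y[OF j]] constants_pos(3)
      by (intro add_left_mono divide_right_mono) auto
    finally have "p j * log 2 (1 + min (real (R j)) (max 1 (w j)))
        \<le> p j * (1 + (log 2 (1 + real (\<Delta> j)) + (y j / ln 2) / \<alpha>))"
      by (intro mult_left_mono) auto
    also have "\<dots> = p j * log 2 (1 + real (\<Delta> j)) + (p j + p j * y j / (\<alpha> * ln 2))"
      by (simp add: algebra_simps)
    finally show "p j * log 2 (1 + min (real (R j)) (max 1 (w j)))
        \<le> p j * log 2 (1 + real (\<Delta> j)) + (p j + p j * y j / (\<alpha> * ln 2))" .
  qed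
  also have "\<dots> = cost \<mu> m I \<Delta> - H + (1 + (\<Sum>j\<in>{1..m}. p j * y j) / (\<alpha> * ln 2))"
    by (simp add: sum.distrib leaf_mass_sum cost_def sum_divide_distrib del: One_nat_def)
  also have "\<dots> \<le> cost \<mu> m I \<Delta> - H + (1 + (1 / a) / (\<alpha> * ln 2))"
    using weighted_overshoot_le[OF assms] constants_pos(3)
    by (intro add_left_mono divide_right_mono) (auto simp: y_def)
  finally show ?thesis
    by (simp add: mult_ac)
qed

section \<open>The rounded allocation: widths, cost and feasibility\<close>

definition rounded_allocation :: "nat \<Rightarrow> nat" where
  "rounded_allocation =
     (\<lambda>j\<in>{1..m}. min (R j) (nat \<lceil>rounding_factor b \<alpha> * max 1 (w j)\<rceil>))"

text \<open>Rounding up adds at most 1, and one more comes from \<open>1 + \<Delta>\<close>. As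
  \<open>t \<ge> 1\<close>, both are absorbed: \<open>K * t + 2 \<le> (K + 2) * t\<close>. The lower
  bound uses \<open>K \<ge> 1\<close>.\<close>

lemma rounded_allocation_width:
  assumes "j \<in> {1..m}"
  shows "target_width S \<mu> m I \<alpha> \<kappa> B j \<le> 1 + real (rounded_allocation j)"
    and "1 + real (rounded_allocation j)
      \<le> (rounding_factor b \<alpha> + 2) * target_width S \<mu> m I \<alpha> \<kappa> B j"
proof -
  define K where "K = rounding_factor b \<alpha>"
  define t where "t = max 1 (w j)"
  define n where "n = nat \<lceil>K * t\<rceil>"
  have K: "1 \<le> K" and t: "1 \<le> t"
    using rounding_factor_ge_1 constants_pos by (auto simp: K_def t_def)
  have tK: "t \<le> K * t"
    using K t mult_right_mono[of 1 K t] by simp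
  have n: "K * t \<le> real n" "real n \<le> K * t + 1"
    using tK t unfolding n_def by linarith+
  have \<Delta>: "rounded_allocation j = min (R j) n"
    using assms by (simp add: rounded_allocation_def n_def K_def t_def)
  have T: "target_width S \<mu> m I \<alpha> \<kappa> B j = min (1 + real (R j)) t"
    by (simp add: target_width_def t_def)
  show "target_width S \<mu> m I \<alpha> \<kappa> B j \<le> 1 + real (rounded_allocation j)"
    unfolding \<Delta> T using n tK by (auto simp: min_def)
  have "1 + real (min (R j) n) \<le> 1 * (1 + real (R j))"
    by simp
  also have "\<dots> \<le> (K + 2) * (1 + real (R j))"
    using K by (intro mult_right_mono) auto
  finally have "1 + real (min (R j) n) \<le> (K + 2) * (1 + real (R j))" .
  moreover have "1 + real (min (R j) n) \<le> (K + 2) * t"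
    using n t by (auto simp: distrib_right min_def)
  ultimately show "1 + real (rounded_allocation j)
      \<le> (rounding_factor b \<alpha> + 2) * target_width S \<mu> m I \<alpha> \<kappa> B j"
    unfolding \<Delta> T K_def[symmetric] by (auto simp: min_def)
qed

text \<open>A constant factor on all widths costs only its logarithm, because the masses sum to
  1.\<close>

lemma cost_rounded_allocation:
  "cost \<mu> m I rounded_allocation \<le> F + log 2 (rounding_factor b \<alpha> + 2)"
proof -
  define K where "K = rounding_factor b \<alpha>"
  have K: "1 \<le> K"
    using rounding_factor_ge_1 constants_pos by (simp add: K_def)
  have "(\<Sum>j\<in>{1..m}. p j * log 2 (1 + real (rounded_allocation j)))
    \<le> (\<Sum>j\<in>{1..m}. p j * log 2 (K + 2)
          + p j * log 2 (1 + min (real (R j)) (max 1 (w j))))"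
  proof (intro sum_mono)
    fix j assume j: "j \<in> {1..m}"
    define T where "T = 1 + min (real (R j)) (max 1 (w j))"
    \<comment> \<open>The two formulas place the 1 differently: \<open>target_width\<close> caps at
      \<open>1 + R j\<close>, whereas \<open>T\<close> adds 1 to a value capped at
      \<open>R j\<close>.\<close>
    have T: "1 \<le> T" "target_width S \<mu> m I \<alpha> \<kappa> B j \<le> T"
      by (auto simp: T_def target_width_def min_def max_def)
    have "1 + real (rounded_allocation j) \<le> (K + 2) * target_width S \<mu> m I \<alpha> \<kappa> B j"
      using rounded_allocation_width(2)[OF j] by (simp add: K_def)
    also have "\<dots> \<le> (K + 2) * T"
      using T K by (intro mult_left_mono) auto
    finally have "log 2 (1 + real (rounded_allocation j)) \<le> log 2 ((K + 2) * T)"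
      using T K by (subst log_le_cancel_iff) auto
    also have "\<dots> = log 2 (K + 2) + log 2 T"
      using T K by (subst log_mult) auto
    finally have "p j * log 2 (1 + real (rounded_allocation j)) \<le> p j * (log 2 (K + 2) + log 2 T)"
      by (intro mult_left_mono) auto
    thus "p j * log 2 (1 + real (rounded_allocation j))
      \<le> p j * log 2 (K + 2) + p j * log 2 (1 + min (real (R j)) (max 1 (w j)))"
      by (simp add: distrib_left T_def)
  qed
  also have "\<dots> = log 2 (K + 2)
      + (\<Sum>j\<in>{1..m}. p j * log 2 (1 + min (real (R j)) (max 1 (w j))))"
    by (simp add: sum.distrib sum_distrib_right[symmetric] leaf_mass_sum del: One_nat_def)
  finally show ?thesis
    by (simp add: cost_def profile_cost_def K_def)
qed

text \<open>A leaf truncated at \<open>R j\<close> is free; \<open>max 0\<close> keeps the bound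
  nonnegative for it when \<open>b < 1\<close>. Any other leaf uses, beyond \<open>b - 1\<close>
  atoms, a share of the effective budget proportional to its mass.\<close>

lemma atoms_rounded_allocation:
  assumes j: "j \<in> {1..m}"
  shows "real (atoms j (rounded_allocation j))
    \<le> max 0 (b - 1) + b / (b + 1)\<^sup>2 * ((B + real m) * p j)"
proof -
  define K where "K = rounding_factor b \<alpha>"
  define n where "n = nat \<lceil>K * max 1 (w j)\<rceil>"
  have N: "0 < B + real m"
    using budget_nonneg m_pos by simp
  have \<Delta>: "rounded_allocation j = min (R j) n"
    using assms by (simp add: rounded_allocation_def n_def K_def)
  show ?thesis
  proof (cases "R j \<le> n")
    case True
    thus ?thesis
      using j N constants_pos by (simp add: \<Delta> min_def atoms_rank_diam)
  next
    case False
    have K: "1 \<le> K" "K powr (-\<alpha>) = 1 / (b + 1)\<^sup>2"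
      using rounding_factor_ge_1 rounding_factor_powr constants_pos by (simp_all add: K_def)
    have x: "0 < x j"
      by (rule ratio_pos[OF j])
    have "K * w j \<le> K * max 1 (w j)"
      using K by simp
    also have "\<dots> \<le> real n"
      unfolding n_def by linarith
    \<comment> \<open>The power is decreasing, so \<open>1 + n\<close> may be replaced by the
      smaller \<open>K * w j\<close>. The factor \<open>K\<close> then yields
      \<open>1 / (b + 1)\<^sup>2\<close> and \<open>w j\<close> yields \<open>1 / x j\<close>, which
      turns \<open>\<kappa> j\<close> into \<open>(B + m) * p j\<close>.\<close>
    finally have "(1 + real n) powr (-\<alpha>) \<le> (K * w j) powr (-\<alpha>)"
      using K x constants_pos by (intro powr_mono2') auto
    also have "\<dots> = 1 / (b + 1)\<^sup>2 * (1 / x j)"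
      using K x constants_pos by (simp add: powr_mult powr_powr powr_minus divide_inverse)
    finally have "\<kappa> j * (1 + real n) powr (-\<alpha>) \<le> \<kappa> j * (1 / (b + 1)\<^sup>2 * (1 / x j))"
      using hardness_pos[OF j] by (intro mult_left_mono) auto
    also have "\<dots> = 1 / (b + 1)\<^sup>2 * ((B + real m) * p j)"
      using x by (subst hardness_eq[OF j]) (simp add: mult_ac)
    finally have "b * (\<kappa> j * (1 + real n) powr (-\<alpha>)) \<le> b * (1 / (b + 1)\<^sup>2 * ((B + real m) * p j))"
      using constants_pos by (intro mult_left_mono) auto
    moreover have "1 + real (atoms j n) \<le> b * (1 + \<kappa> j * (1 + real n) powr (-\<alpha>))"
      using False by (intro atoms_bounds j) auto
    ultimately show ?thesis
      using False by (simp add: \<Delta> min_def distrib_left)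
  qed
qed

lemma rounded_allocation_feasible:
  assumes "max 0 (b - 1) * real m + b / (b + 1)\<^sup>2 * (B + real m) \<le> D"
  shows "rounded_allocation \<in> feasible S M m I D"
proof -
  have "(\<Sum>j\<in>{1..m}. real (atoms j (rounded_allocation j)))
      \<le> (\<Sum>j\<in>{1..m}. max 0 (b - 1) + b / (b + 1)\<^sup>2 * ((B + real m) * p j))"
    by (intro sum_mono atoms_rounded_allocation)
  also have "\<dots> = real m * max 0 (b - 1) + b / (b + 1)\<^sup>2 * ((B + real m) * (\<Sum>j\<in>{1..m}. p j))"
    unfolding sum.distrib sum_distrib_left by simp
  also have "\<dots> = max 0 (b - 1) * real m + b / (b + 1)\<^sup>2 * (B + real m)"
    unfolding leaf_mass_sum by simp
  finally show ?thesis
    using assms by (auto simp: feasible_iff rounded_allocation_def)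
qed

text \<open>The hypothesis gives \<open>b * (B + m) \<le> (b + 1) * B\<close>, so the mass-dependent
  part takes at most \<open>B / (b + 1)\<close>. The remaining \<open>b * B / (b + 1)\<close> has to
  cover the \<open>b - 1\<close> atoms per leaf.\<close>

lemma rounded_allocation_feasible_budget:
  assumes "b * real m \<le> B"
  shows "rounded_allocation \<in> feasible S M m I B"
proof (rule rounded_allocation_feasible)
  have b: "0 < b"
    by (rule constants_pos)
  have "b / (b + 1)\<^sup>2 * (B + real m) = (b * B + b * real m) / (b + 1)\<^sup>2"
    by (simp add: distrib_left add_divide_distrib)
  also have "\<dots> \<le> (b * B + B) / (b + 1)\<^sup>2"
    using assms by (intro divide_right_mono) auto
  also have "\<dots> = B / (b + 1)"
    using b by (simp add: power2_eq_square divide_simps) (simp add: algebra_simps)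
  finally have *: "b / (b + 1)\<^sup>2 * (B + real m) \<le> B / (b + 1)" .
  have "max 0 (b - 1) * real m \<le> B - B / (b + 1)"
  proof (cases "b \<le> 1")
    case True
    thus ?thesis
      using b budget_nonneg by (simp add: max_def field_simps)
  next
    case False
    \<comment> \<open>The claim is multiplied by \<open>b\<close> to bring in the hypothesis; what
      remains after clearing \<open>b + 1\<close> is
      \<open>b\<^sup>2 - 1 \<le> b\<^sup>2\<close>.\<close>
    have "b * real m * (b - 1) \<le> B * (b - 1)"
      using False assms by (intro mult_right_mono) auto
    also have "\<dots> \<le> b * (B - B / (b + 1))"
      using b budget_nonneg by (simp add: field_simps)
    finally have "b * ((b - 1) * real m) \<le> b * (B - B / (b + 1))"
      by (simp add: mult_ac)
    thus ?thesis
      using False b by simp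
  qed
  with * show "max 0 (b - 1) * real m + b / (b + 1)\<^sup>2 * (B + real m) \<le> B"
    by simp
qed

text \<open>The weights \<open>max 0 (b - 1)\<close> and \<open>min b 1\<close> add up to
  \<open>b\<close>, and the second dominates \<open>b / (b + 1)\<^sup>2\<close>. This works however
  small \<open>B\<close> is compared with \<open>m\<close>.\<close>

lemma rounded_allocation_feasible_scaled:
  "rounded_allocation \<in> feasible S M m I (b * (B + real m))"
proof (rule rounded_allocation_feasible)
  have b: "0 < b"
    by (rule constants_pos)
  have "max 0 (b - 1) * real m \<le> max 0 (b - 1) * (B + real m)"
    using budget_nonneg by (intro mult_left_mono) auto
  moreover have "b / (b + 1)\<^sup>2 \<le> min b 1"
    using b by (simp add: power2_eq_square divide_simps) (simp add: algebra_simps)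
  hence "b / (b + 1)\<^sup>2 * (B + real m) \<le> min b 1 * (B + real m)"
    using budget_nonneg by (intro mult_right_mono) auto
  moreover have "max 0 (b - 1) * (B + real m) + min b 1 * (B + real m) = b * (B + real m)"
    by (auto simp: max_def min_def algebra_simps)
  ultimately show "max 0 (b - 1) * real m + b / (b + 1)\<^sup>2 * (B + real m) \<le> b * (B + real m)"
    by linarith
qed

section \<open>The interior regime\<close>

text \<open>On a contributing leaf neither the truncation nor the maximum is active, and
  \<open>log 2 (1 + w j)\<close> exceeds \<open>log 2 (w j)\<close> by at most 1. Weighted by
  masses, the leafwise errors again sum to at most 1.\<close>

lemma profile_cost_interior:
  assumes "interior_regime S \<mu> m I \<alpha> \<kappa> B C" "1 \<le> C"
  shows "G \<le> F" "F \<le> G + 1"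
proof -
  have summand: "max 0 (log 2 (x j)) / \<alpha> \<le> log 2 (1 + min (real (R j)) (max 1 (w j)))
      \<and> log 2 (1 + min (real (R j)) (max 1 (w j))) \<le> max 0 (log 2 (x j)) / \<alpha> + 1"
    if j: "j \<in> {1..m}" for j
  proof (cases "1 < x j")
    case True
    hence w: "1 \<le> w j" "w j \<le> real (R j)"
      using assms j by (auto simp: interior_regime_def)
    have "log 2 (w j) \<le> log 2 (1 + w j)" "log 2 (1 + w j) \<le> log 2 (2 * w j)"
      by (intro log_mono; use w in linarith)+
    moreover have "log 2 (2 * w j) = 1 + log 2 (w j)"
      using w by (subst log_mult) auto
    ultimately show ?thesis
      using w True log_width[OF j] by (simp add: max_def min_def)
  next
    case False
    have x: "0 < x j"
      by (rule ratio_pos[OF j])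
    hence "w j \<le> 1"
      using False constants_pos powr_mono2[of "1 / \<alpha>" "x j" 1] by simp
    \<comment> \<open>As \<open>R j \<ge> 1\<close>, the profile summand is exactly
      \<open>log 2 2 = 1\<close>, against 0 in the interior cost.\<close>
    thus ?thesis
      using False x rank_diam_ge_1[of j] by (simp add: max_def min_def)
  qed
  have G: "G = H + (\<Sum>j\<in>{1..m}. p j * (max 0 (log 2 (x j)) / \<alpha>))"
    by (simp add: interior_cost_def sum_distrib_left divide_simps del: One_nat_def)
  show "G \<le> F"
    unfolding G profile_cost_def using summand
    by (intro add_left_mono sum_mono mult_left_mono) auto
  have "F \<le> H + (\<Sum>j\<in>{1..m}. p j * (max 0 (log 2 (x j)) / \<alpha> + 1))"
    unfolding profile_cost_def using summand
    by (intro add_left_mono sum_mono mult_left_mono) auto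
  also have "\<dots> = G + 1"
    unfolding G by (simp add: distrib_left sum.distrib leaf_mass_sum del: One_nat_def)
  finally show "F \<le> G + 1" .
qed

definition contributing :: "nat set" where
  "contributing = {j \<in> {1..m}. 1 < x j}"

lemma interior_cost_eq: "G = H + (\<Sum>j\<in>contributing. p j * log 2 (w j))"
proof -
  have "(\<Sum>j\<in>{1..m}. p j * max 0 (log 2 (x j))) = (\<Sum>j\<in>contributing. p j * log 2 (x j))"
    using ratio_pos
    by (intro sum.mono_neutral_cong_right) (auto simp: contributing_def max_def less_le)
  moreover have "(\<Sum>j\<in>contributing. p j * log 2 (w j)) = 1 / \<alpha> * (\<Sum>j\<in>contributing. p j * log 2 (x j))"
    unfolding sum_distrib_left by (intro sum.cong refl) (simp add: contributing_def log_width)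
  ultimately show ?thesis
    by (simp add: interior_cost_def)
qed

text \<open>This lets errors proportional to the contributing mass be charged to the repair term,
  once \<open>C\<close> is large.\<close>

lemma contributing_mass_bound:
  assumes "interior_regime S \<mu> m I \<alpha> \<kappa> B C" "1 \<le> C"
  shows "(\<Sum>j\<in>contributing. p j) * log 2 C \<le> (\<Sum>j\<in>contributing. p j * log 2 (w j))"
  unfolding sum_distrib_right using assms
  by (intro sum_mono mult_left_mono)
     (auto simp: contributing_def interior_regime_def intro!: log_mono)

text \<open>An additive error would be useless where the optimum is close to 0, so every error must
  be charged to the entropy or to half of the repair term \<open>L\<close> itself.\<close>

lemma interior_cost_le_cost:
  assumes interior: "interior_regime S \<mu> m I \<alpha> \<kappa> B C" and C: "1 \<le> C" "(1 + 1 / a) powr (2 / \<alpha>) \<le> C"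
    and feasible: "\<Delta> \<in> feasible S M m I B"
  shows "G \<le> (3 + 2 / \<alpha>) * cost \<mu> m I \<Delta>"
proof -
  define L where "L = (\<Sum>j\<in>contributing. p j * log 2 (w j))"
  define P where "P = (\<Sum>j\<in>contributing. p j)"
  define q where "q = log 2 (1 + 1 / a)"
  define D where "D = (\<Sum>j\<in>{1..m}. p j * log 2 (1 + real (\<Delta> j)))"
  have pos: "0 < a" "0 < \<alpha>"
    using constants_pos by auto
  have "P * q / \<alpha> = P * (2 / \<alpha> * q) / 2"
    by simp
  \<comment> \<open>The exponent \<open>2 / \<alpha>\<close> in the threshold for \<open>C\<close>
    is what makes this error at most half of \<open>L\<close>.\<close>
  also have "2 / \<alpha> * q = log 2 ((1 + 1 / a) powr (2 / \<alpha>))"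
    using pos add_pos_pos[of 1 "1 / a"] by (simp add: q_def log_powr less_imp_neq[symmetric])
  also have "P * log 2 ((1 + 1 / a) powr (2 / \<alpha>)) / 2 \<le> P * log 2 C / 2"
    using pos C add_pos_pos[of 1 "1 / a"]
    by (intro divide_right_mono mult_left_mono log_mono)
      (auto simp: P_def less_imp_neq[symmetric] intro: sum_nonneg)
  also have "\<dots> \<le> L / 2"
    using contributing_mass_bound[OF interior C(1)] by (simp add: P_def L_def)
  finally have absorbed: "P * q / \<alpha> \<le> L / 2" .
  have "L \<le> (\<Sum>j\<in>contributing. p j * log 2 (1 + real (\<Delta> j)) + p j * log 2 (1 / p j) / \<alpha> + p j * q / \<alpha>)"
    unfolding L_def
  proof (intro sum_mono)
    fix j assume "j \<in> contributing"
    hence j: "j \<in> {1..m}" and x: "1 < x j"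
      by (auto simp: contributing_def)
    define y where "y = x j * (1 + real (\<Delta> j)) powr (-\<alpha>)"
    have y: "0 \<le> y"
      using x by (simp add: y_def)
    have pj: "0 < p j" "p j \<le> 1"
      using leaf_pos[OF j] by auto
    \<comment> \<open>A single summand is at most the whole nonnegative sum; the resulting factor
      \<open>1 / p j\<close> inside the logarithm becomes an entropy term.\<close>
    have "p j * y \<le> (\<Sum>i\<in>{1..m}. p i * (x i * (1 + real (\<Delta> i)) powr (-\<alpha>)))"
      unfolding y_def using ratio_pos j
      by (intro member_le_sum[of j "{1..m}" "\<lambda>i. p i * (x i * (1 + real (\<Delta> i)) powr (-\<alpha>))"])
         (auto intro!: mult_nonneg_nonneg simp: less_imp_le)
    also have "\<dots> \<le> 1 / a"
      by (rule weighted_overshoot_le[OF feasible])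
    finally have "p j * (1 + y) \<le> 1 + 1 / a"
      using pj(2) unfolding distrib_left by linarith
    hence "1 + y \<le> 1 / p j * (1 + 1 / a)"
      using pj(1) by (simp add: pos_le_divide_eq mult.commute)
    hence "log 2 (1 + y) \<le> log 2 (1 / p j * (1 + 1 / a))"
      using y by (intro log_mono) auto
    also have "\<dots> = log 2 (1 / p j) + q"
      unfolding q_def using pj add_pos_pos[of 1 "1 / a"] pos by (subst log_mult) auto
    finally have "log 2 (1 + y) / \<alpha> \<le> (log 2 (1 / p j) + q) / \<alpha>"
      using pos by (intro divide_right_mono) auto
    moreover have "log 2 (w j) \<le> log 2 (max 1 (w j))"
      using x by (intro log_mono) auto
    moreover have "log 2 (max 1 (w j)) \<le> log 2 (1 + real (\<Delta> j)) + log 2 (1 + y) / \<alpha>"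
      unfolding y_def by (rule log_width_le[OF j])
    ultimately have "p j * log 2 (w j) \<le> p j * (log 2 (1 + real (\<Delta> j)) + (log 2 (1 / p j) + q) / \<alpha>)"
      by (intro mult_left_mono) auto
    thus "p j * log 2 (w j) \<le> p j * log 2 (1 + real (\<Delta> j)) + p j * log 2 (1 / p j) / \<alpha> + p j * q / \<alpha>"
      by (simp only: distrib_left add_divide_distrib times_divide_eq_right add.assoc)
  qed
  also have "\<dots> = (\<Sum>j\<in>contributing. p j * log 2 (1 + real (\<Delta> j)))
      + (\<Sum>j\<in>contributing. p j * log 2 (1 / p j)) / \<alpha> + P * q / \<alpha>"
    by (simp add: sum.distrib P_def sum_divide_distrib sum_distrib_right)
  also have "\<dots> \<le> D + H / \<alpha> + L / 2"
  proof (intro add_mono absorbed divide_right_mono)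
    show "(\<Sum>j\<in>contributing. p j * log 2 (1 + real (\<Delta> j))) \<le> D"
      unfolding D_def by (intro sum_mono2) (auto simp: contributing_def)
    show "(\<Sum>j\<in>contributing. p j * log 2 (1 / p j)) \<le> H"
      unfolding partition_entropy_def using entropy_term_nonneg
      by (intro sum_mono2) (auto simp: contributing_def)
  qed (use pos in auto)
  \<comment> \<open>The \<open>L / 2\<close> on the right is moved to the left and the inequality
    doubled.\<close>
  finally have "L \<le> 2 * D + 2 / \<alpha> * H"
    by simp
  hence "G \<le> H + 2 * D + 2 / \<alpha> * H"
    by (simp add: interior_cost_eq L_def)
  also have "\<dots> \<le> (3 + 2 / \<alpha>) * (H + D)"
  proof -
    have "0 \<le> D"
      unfolding D_def by (intro sum_nonneg) auto
    moreover from this have "0 \<le> 2 / \<alpha> * D"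
      using pos by simp
    ultimately show ?thesis
      using entropy_nonneg by (simp add: distrib_left distrib_right)
  qed
  finally show ?thesis
    by (simp add: cost_def D_def)
qed

text \<open>For \<open>C \<ge> 2\<close> the repair term is at least the contributing mass, and the
  two masses add up to 1. This turns additive constants into multiplicative ones.\<close>

lemma interior_cost_plus_mass_ge_1:
  assumes "interior_regime S \<mu> m I \<alpha> \<kappa> B C" "2 \<le> C"
  shows "1 \<le> G + noncontributing_mass \<mu> m I \<kappa> B"
proof -
  define P where "P = (\<Sum>j\<in>contributing. p j)"
  have "{1..m} = contributing \<union> {j \<in> {1..m}. x j \<le> 1}"
    by (auto simp: contributing_def)
  hence "1 = (\<Sum>j\<in>contributing \<union> {j \<in> {1..m}. x j \<le> 1}. p j)"
    using leaf_mass_sum by metis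
  also have "\<dots> = P + noncontributing_mass \<mu> m I \<kappa> B"
    unfolding P_def noncontributing_mass_def
    by (intro sum.union_disjoint) (auto simp: contributing_def)
  finally have mass: "1 = P + noncontributing_mass \<mu> m I \<kappa> B" .
  have "log 2 2 \<le> log 2 C"
    using assms by (intro log_mono) auto
  hence "P * 1 \<le> P * log 2 C"
    by (intro mult_left_mono) (auto simp: P_def intro: sum_nonneg)
  also have "\<dots> \<le> G"
    using contributing_mass_bound[OF assms(1)] assms(2) entropy_nonneg
    by (simp add: interior_cost_eq P_def)
  finally show ?thesis
    using mass by simp
qed

end

section \<open>The bounds with a common constant\<close>

theorem theorem2:
  fixes a b \<alpha> :: real
  assumes "0 < a" and "0 < b" and "0 < \<alpha>"
  shows "\<exists>C\<ge>1. \<forall>(S :: 'a::linorder set) (\<mu> :: 'a measure)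
      (decode :: 'a set \<Rightarrow> 'r list \<Rightarrow> 'a \<Rightarrow> real) (M :: 'a set \<Rightarrow> nat \<Rightarrow> ('a \<Rightarrow> real) set)
      (m :: nat) (I :: nat \<Rightarrow> 'a set) (\<kappa> :: nat \<Rightarrow> real) (B :: real).
    finite S \<longrightarrow>
    prob_space \<mu> \<longrightarrow> space \<mu> = UNIV \<longrightarrow>
    atomized_family S decode M \<longrightarrow>
    ordered_partition m I \<longrightarrow>
    (\<forall>j\<in>{1..m}. I j \<in> sets \<mu> \<and> 0 < measure \<mu> (I j)) \<longrightarrow>
    power_law_profile S M m I a b \<alpha> \<kappa> \<longrightarrow>
    0 \<le> B \<longrightarrow>
    (let OPT = opt_cost S \<mu> M m I B;
         F = profile_cost S \<mu> m I \<alpha> \<kappa> B;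
         G = interior_cost \<mu> m I \<alpha> \<kappa> B
     in
       F \<le> OPT + C \<and>
       (b * real m \<le> B \<longrightarrow> OPT \<le> F + C) \<and>
       opt_cost S \<mu> M m I (b * (B + real m)) \<le> F + C \<and>
       (interior_regime S \<mu> m I \<alpha> \<kappa> B C \<longrightarrow>
          \<bar>F - G\<bar> \<le> 1 \<and>
          G \<le> C * OPT \<and>
          (b * real m \<le> B \<longrightarrow>
             OPT \<le> C * (G + noncontributing_mass \<mu> m I \<kappa> B))) \<and>
       (b * real m \<le> B \<longrightarrow>
          (\<exists>\<Delta>\<in>feasible S M m I B.
             cost \<mu> m I \<Delta> \<le> OPT + C \<and>
             (\<forall>j\<in>{1..m}.
                target_width S \<mu> m I \<alpha> \<kappa> B j / C \<le> 1 + real (\<Delta> j) \<and>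
                1 + real (\<Delta> j) \<le> C * target_width S \<mu> m I \<alpha> \<kappa> B j))))"
proof -
  define K where "K = rounding_factor b \<alpha>"
  define c where "c = 1 + 1 / (\<alpha> * a * ln 2)"
  \<comment> \<open>Chosen before the instance, from \<open>a\<close>, \<open>b\<close> and
    \<open>\<alpha>\<close> alone. All summands are nonnegative, so \<open>C\<close> dominates each
    constant of the lemmas; it also serves as the threshold of the interior regime.\<close>
  define C where "C = c + log 2 (K + 2) + (1 + 1 / a) powr (2 / \<alpha>) + (3 + 2 / \<alpha>) + (K + 2)"
  have K: "1 \<le> K"
    using assms by (simp add: K_def rounding_factor_ge_1)
  have nonneg: "0 \<le> log 2 (K + 2)" "0 \<le> (1 + 1 / a) powr (2 / \<alpha>)" "1 \<le> c" "0 \<le> 2 / \<alpha>"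
    using K assms by (auto simp: c_def)
  have C: "2 \<le> C" "c + log 2 (K + 2) \<le> C" "2 + log 2 (K + 2) \<le> C" "(1 + 1 / a) powr (2 / \<alpha>) \<le> C"
    "3 + 2 / \<alpha> \<le> C" "K + 2 \<le> C"
    using K nonneg unfolding C_def by linarith+
  show ?thesis
  proof (rule exI[of _ C], intro conjI allI impI)
    show "1 \<le> C"
      using C by simp
  next
    fix S :: "'a set" and \<mu> :: "'a measure" and decode :: "'a set \<Rightarrow> 'r list \<Rightarrow> 'a \<Rightarrow> real"
      and M :: "'a set \<Rightarrow> nat \<Rightarrow> ('a \<Rightarrow> real) set" and m :: nat and I :: "nat \<Rightarrow> 'a set"
      and \<kappa> :: "nat \<Rightarrow> real" and B :: real
    assume "prob_space \<mu>" and "space \<mu> = UNIV" and "ordered_partition m I"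
      and "\<forall>j\<in>{1..m}. I j \<in> sets \<mu> \<and> 0 < measure \<mu> (I j)"
      and "power_law_profile S M m I a b \<alpha> \<kappa>" and "0 \<le> B"
    then interpret profiled_partition \<mu> S M m I a b \<alpha> \<kappa> B
      by (intro profiled_partition.intro profiled_partition_axioms.intro) auto
    obtain \<Delta> where \<Delta>: "\<Delta> \<in> feasible S M m I B" "OPT B = cost \<mu> m I \<Delta>"
      using opt_cost_attained[OF \<open>0 \<le> B\<close>] by blast
    have F: "F \<le> OPT B + c"
      using profile_cost_le_cost[OF \<Delta>(1)] by (simp add: \<Delta>(2) c_def)
    have r: "cost \<mu> m I rounded_allocation \<le> F + log 2 (K + 2)"
      using cost_rounded_allocation by (simp add: K_def)
    have upper: "OPT B \<le> F + log 2 (K + 2)" if "b * real m \<le> B"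
      using opt_cost_le[OF rounded_allocation_feasible_budget[OF that]] r by linarith
    have scaled: "OPT (b * (B + real m)) \<le> F + C"
      using opt_cost_le[OF rounded_allocation_feasible_scaled] r C nonneg by linarith
    have interior: "\<bar>F - G\<bar> \<le> 1 \<and> G \<le> C * OPT B \<and>
        (b * real m \<le> B \<longrightarrow> OPT B \<le> C * (G + noncontributing_mass \<mu> m I \<kappa> B))"
      if regime: "interior_regime S \<mu> m I \<alpha> \<kappa> B C"
    proof (intro conjI impI)
      have FG: "G \<le> F" "F \<le> G + 1"
        using profile_cost_interior[OF regime] C by auto
      thus "\<bar>F - G\<bar> \<le> 1"
        by simp
      \<comment> \<open>Enlarging the factor \<open>3 + 2 / \<alpha>\<close> to \<open>C\<close>
        needs a nonnegative optimum.\<close>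
      have "0 \<le> OPT B"
        unfolding \<Delta>(2) cost_def using entropy_nonneg by (intro add_nonneg_nonneg sum_nonneg) auto
      hence "(3 + 2 / \<alpha>) * OPT B \<le> C * OPT B"
        using C by (intro mult_right_mono) auto
      moreover have "G \<le> (3 + 2 / \<alpha>) * OPT B"
        unfolding \<Delta>(2) using interior_cost_le_cost[OF regime _ _ \<Delta>(1)] C by auto
      ultimately show "G \<le> C * OPT B"
        by linarith
      define Q where "Q = noncontributing_mass \<mu> m I \<kappa> B"
      have Q: "0 \<le> Q"
        unfolding Q_def noncontributing_mass_def by (intro sum_nonneg) auto
      have GQ: "1 \<le> G + Q"
        using interior_cost_plus_mass_ge_1[OF regime] C by (simp add: Q_def)
      assume "b * real m \<le> B"
      from upper[OF this] FG Q have "OPT B \<le> (G + Q) + (1 + log 2 (K + 2)) * 1"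
        by simp
      \<comment> \<open>Since \<open>G + Q \<ge> 1\<close>, the additive constant is at most its
        product with \<open>G + Q\<close>.\<close>
      also have "\<dots> \<le> (G + Q) + (1 + log 2 (K + 2)) * (G + Q)"
        using nonneg GQ by (intro add_left_mono mult_left_mono) auto
      also have "\<dots> = (2 + log 2 (K + 2)) * (G + Q)"
        by (simp add: algebra_simps)
      also have "\<dots> \<le> C * (G + Q)"
        using C GQ by (intro mult_right_mono) auto
      finally show "OPT B \<le> C * (G + noncontributing_mass \<mu> m I \<kappa> B)"
        by (simp add: Q_def)
    qed
    have allocation: "\<exists>\<Delta>\<in>feasible S M m I B. cost \<mu> m I \<Delta> \<le> OPT B + C \<and>
        (\<forall>j\<in>{1..m}. target_width S \<mu> m I \<alpha> \<kappa> B j / C \<le> 1 + real (\<Delta> j) \<and>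
           1 + real (\<Delta> j) \<le> C * target_width S \<mu> m I \<alpha> \<kappa> B j)"
      if "b * real m \<le> B"
    proof (intro bexI[of _ rounded_allocation] conjI ballI)
      show "rounded_allocation \<in> feasible S M m I B"
        by (rule rounded_allocation_feasible_budget[OF that])
      \<comment> \<open>Two losses add up: the allocation against the profile cost, and the profile
        cost against the optimum.\<close>
      show "cost \<mu> m I rounded_allocation \<le> OPT B + C"
        using r F C by linarith
      fix j assume j: "j \<in> {1..m}"
      define T where "T = target_width S \<mu> m I \<alpha> \<kappa> B j"
      have T: "0 \<le> T"
        by (simp add: T_def target_width_def)
      have "T \<le> C * T"
        using C T mult_right_mono[of 1 C T] by simp
      hence "T / C \<le> T"
        using C by (simp add: field_simps)
      thus "T / C \<le> 1 + real (rounded_allocation j)"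
        using rounded_allocation_width(1)[OF j] by (simp add: T_def)
      have "(K + 2) * T \<le> C * T"
        using C T by (intro mult_right_mono) auto
      thus "1 + real (rounded_allocation j) \<le> C * T"
        using rounded_allocation_width(2)[OF j] by (simp add: T_def K_def)
    qed
    show "let OPT = opt_cost S \<mu> M m I B;
         F = profile_cost S \<mu> m I \<alpha> \<kappa> B;
         G = interior_cost \<mu> m I \<alpha> \<kappa> B
     in
       F \<le> OPT + C \<and>
       (b * real m \<le> B \<longrightarrow> OPT \<le> F + C) \<and>
       opt_cost S \<mu> M m I (b * (B + real m)) \<le> F + C \<and>
       (interior_regime S \<mu> m I \<alpha> \<kappa> B C \<longrightarrow>
          \<bar>F - G\<bar> \<le> 1 \<and>
          G \<le> C * OPT \<and>
          (b * real m \<le> B \<longrightarrow>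
             OPT \<le> C * (G + noncontributing_mass \<mu> m I \<kappa> B))) \<and>
       (b * real m \<le> B \<longrightarrow>
          (\<exists>\<Delta>\<in>feasible S M m I B.
             cost \<mu> m I \<Delta> \<le> OPT + C \<and>
             (\<forall>j\<in>{1..m}.
                target_width S \<mu> m I \<alpha> \<kappa> B j / C \<le> 1 + real (\<Delta> j) \<and>
                1 + real (\<Delta> j) \<le> C * target_width S \<mu> m I \<alpha> \<kappa> B j)))"
      unfolding Let_def
    proof (intro conjI)
      show "F \<le> OPT B + C"
        using F C nonneg by linarith
      show "b * real m \<le> B \<longrightarrow> OPT B \<le> F + C"
        using upper C nonneg by (intro impI) linarith
    qed (rule scaled, (rule impI, erule interior), (rule impI, erule allocation))
  qed
qed

end
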